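(* Let $AX=B$, where $A\in\mathbb{R}^{n\times n}$ is an invertible matrix whose entries are differentiable functions of a real parameter vector $\Omega_A=[\omega_1,\ldots,\omega_p,\omega_{p+1},\ldots,\omega_N]^\top\in\mathbb{R}^N$, where $B\in\mathbb{R}^{n\times m}$ is a matrix whose entries are differentiable functions of a real parameter vector $\Omega_B=[\omega_1,\ldots,\omega_p,\omega^B_{p+1},\ldots,\omega^B_M]^\top\in\mathbb{R}^M$ (so that $\omega_1,\dots,\omega_p$ are the parameters common to $A$ and $B$), and where all entries of $X\in\mathbb{R}^{n\times m}$ are nonzero. Let $\mathcal{E}=[e_1,\ldots,e_p,e_{p+1},\ldots,e_N]^\top\in\mathbb{R}^N$ and $f=[e_1,\ldots,e_p,f_{p+1},\ldots,f_M]^\top\in\mathbb{R}^M$ have nonnegative entries. Then the componentwise condition number $\mathscr{K}_{\mathcal{E},f}(A(\Omega_A),B(\Omega_B))$ is given by $$\mathscr{K}_{\mathcal{E},f}(A(\Omega_A),B(\Omega_B))=\frac{1}{\|X\|_{\max}}\left\|\sum_{k=1}^{p}\left|A^{-1}\frac{\partial A}{\partial\omega_k}X-A^{-1}\frac{\partial B}{\partial\omega_k}\right|e_k+\sum_{k=p+1}^{N}\left|A^{-1}\frac{\partial A}{\partial\omega_k}X\right|e_k+\sum_{k=p+1}^{M}\left|A^{-1}\frac{\partial B}{\partial\omega^B_k}\right|f_k\right\|_{\max}.$$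
   Context: For a real matrix $Z=(z_{ij})$, $|Z|$ is the entrywise absolute value and $\|Z\|_{\max}=\max_{i,j}|z_{ij}|$; inequalities between vectors or matrices are entrywise. The condition number is $$\mathscr{K}_{\mathcal{E},f}(A(\Omega_A),B(\Omega_B)):=\lim_{\eta\to0}\sup\left\{\frac{1}{\eta}\frac{\|\delta X\|_{\max}}{\|X\|_{\max}}:\ A(\Omega_A+\delta\Omega_A)(X+\delta X)=B(\Omega_B+\delta\Omega_B),\ |\delta\Omega_A|\le\eta\,\mathcal{E},\ |\delta\Omega_B|\le\eta f\right\},$$ where $\eta>0$ and the first $p$ components of $\delta\Omega_A$ and $\delta\Omega_B$ coincide (both are the perturbations $\delta\omega_1,\dots,\delta\omega_p$ of the common parameters), while all other components are perturbed independently. *)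

theory Defs
  imports "HOL-Analysis.Analysis"
begin

text \<open>
  An \<open>n \<times> m\<close> matrix is an element of \<^typ>\<open>real^'m^'n\<close>; on vectors and matrices the library's
  \<open>\<bar>_\<bar>\<close> and \<open>\<le>\<close> are entrywise.
\<close>

definition max_norm :: "real^'m^'n \<Rightarrow> real" where
  "max_norm Z = Max (range (\<lambda>(i, j). \<bar>Z $ i $ j\<bar>))"

definition matrix_partial :: "(real^'k \<Rightarrow> real^'m^'n) \<Rightarrow> 'k \<Rightarrow> real^'k \<Rightarrow> real^'m^'n" where
  "matrix_partial F k w = (\<chi> i j. deriv (\<lambda>t. F (w + t *\<^sub>R axis k 1) $ i $ j) 0)"

text \<open>
  The parameter spaces \<open>\<real>\<^sup>N\<close> and \<open>\<real>\<^sup>M\<close> are indexed by finite types. The maps \<open>a\<close> and \<open>b\<close> number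
  their components (bijectively, from \<open>{1..N}\<close> and \<open>{1..M}\<close>), so that \<open>w $ a k\<close> is the \<open>k\<close>-th
  component of \<open>w\<close>, and the first \<open>p\<close> components are those at \<open>a k\<close> (resp. \<open>b k\<close>) with
  \<open>1 \<le> k \<le> p\<close>. Common parameters are expressed by equating these components.

  The supremum is taken in the extended reals: for large \<open>\<eta>\<close> the perturbed matrix may become
  singular and the set of perturbations unbounded.
\<close>

definition worst_rel_error ::
  "nat \<Rightarrow> (nat \<Rightarrow> 'N::finite) \<Rightarrow> (nat \<Rightarrow> 'M::finite) \<Rightarrow>
   (real^'N \<Rightarrow> real^'n^'n) \<Rightarrow> real^'N \<Rightarrow> (real^'M \<Rightarrow> real^'m^'n) \<Rightarrow> real^'M \<Rightarrow>
   real^'m^'n \<Rightarrow> real^'N \<Rightarrow> real^'M \<Rightarrow> real \<Rightarrow> ereal" where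
  "worst_rel_error p a b A \<Omega>A B \<Omega>B X E f \<eta> =
     Sup {ereal (1 / \<eta> * (max_norm dX / max_norm X)) | dX dA dB.
            A (\<Omega>A + dA) ** (X + dX) = B (\<Omega>B + dB) \<and>
            \<bar>dA\<bar> \<le> \<eta> *\<^sub>R E \<and> \<bar>dB\<bar> \<le> \<eta> *\<^sub>R f \<and>
            (\<forall>k\<in>{1..p}. dA $ a k = dB $ b k)}"

definition condition_number ::
  "nat \<Rightarrow> (nat \<Rightarrow> 'N::finite) \<Rightarrow> (nat \<Rightarrow> 'M::finite) \<Rightarrow>
   (real^'N \<Rightarrow> real^'n^'n) \<Rightarrow> real^'N \<Rightarrow> (real^'M \<Rightarrow> real^'m^'n) \<Rightarrow> real^'M \<Rightarrow>
   real^'m^'n \<Rightarrow> real^'N \<Rightarrow> real^'M \<Rightarrow> ereal" where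
  "condition_number p a b A \<Omega>A B \<Omega>B X E f =
     Lim (at_right 0) (worst_rel_error p a b A \<Omega>A B \<Omega>B X E f)"

end

theory Submission
  imports Defs
begin

text \<open>
  Write \<open>G\<close> for the inverse of \<open>A \<Omega>A\<close>. Multiplying the perturbed system by \<open>G\<close> and using \<open>A X = B\<close>
  turns it into \<open>U h ** dX = V h\<close>, where \<open>h = (dA, dB)\<close> collects the parameter perturbations, the
  coefficient matrix \<open>U h = G ** A (\<Omega>A + dA)\<close> tends to the identity, and the right-hand side
  \<open>V h = G ** (B (\<Omega>B + dB) - A (\<Omega>A + dA) ** X)\<close> vanishes at \<open>0\<close> and is differentiable there. Hence
  for small \<open>h\<close> the system is uniquely solvable, and its solution differs from \<open>V' h\<close>, the derivative
  of \<open>V\<close> at \<open>0\<close>, by at most \<open>\<epsilon> * norm h\<close> (\<open>linearized_linear_system\<close>). As \<open>norm h\<close> is at most a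
  constant times \<open>\<eta>\<close>, the worst values of \<open>max_norm dX / (\<eta> * max_norm X)\<close> and of
  \<open>max_norm (V' h) / (\<eta> * max_norm X)\<close> have the same limit.
  
  This linear problem is solved exactly. Up to sign, \<open>V' h\<close> is a sum over the independent parameters of
  the perturbation of that parameter times a sensitivity matrix. The two occurrences of a common parameter
  contribute jointly: their matrices are subtracted inside the absolute value. By the triangle
  inequality no entry of \<open>V' h\<close> exceeds in absolute value \<open>\<eta>\<close> times the corresponding weighted sum of
  absolute values
  (\<open>max_norm_weighted_sum_le\<close>). Conversely, at an entry where this weighted sum is largest, giving
  every parameter its full perturbation with the sign of its contribution to that entry attains the
  bound (\<open>max_norm_weighted_sum_attained\<close>). A single entry suffices because the norm is the maximum of
  the entries; no choice of signs need work for all entries at once.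
\<close>

section \<open>The entrywise maximum norm\<close>

lemma abs_entry_le_max_norm: "\<bar>Z $ i $ j\<bar> \<le> max_norm Z"
  unfolding max_norm_def by (rule Max_ge) (auto intro: rev_image_eqI[of "(i, j)"])

lemma max_norm_attained: obtains i j where "max_norm Z = \<bar>Z $ i $ j\<bar>"
proof -
  have "max_norm Z \<in> range (\<lambda>(i, j). \<bar>Z $ i $ j\<bar>)"
    unfolding max_norm_def by (rule Max_in) auto
  then show ?thesis using that by auto
qed

lemma max_norm_le_iff: "max_norm Z \<le> c \<longleftrightarrow> (\<forall>i j. \<bar>Z $ i $ j\<bar> \<le> c)"
  by (metis abs_entry_le_max_norm max_norm_attained order_trans)

lemma max_norm_scaleR: "max_norm (c *\<^sub>R Z) = \<bar>c\<bar> * max_norm Z"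
proof (rule antisym)
  show "max_norm (c *\<^sub>R Z) \<le> \<bar>c\<bar> * max_norm Z"
    by (auto simp: max_norm_le_iff abs_mult intro: mult_left_mono abs_entry_le_max_norm)
  obtain i j where "max_norm Z = \<bar>Z $ i $ j\<bar>" by (rule max_norm_attained)
  then have "\<bar>c\<bar> * max_norm Z = \<bar>(c *\<^sub>R Z) $ i $ j\<bar>" by (simp add: abs_mult)
  then show "\<bar>c\<bar> * max_norm Z \<le> max_norm (c *\<^sub>R Z)"
    by (metis abs_entry_le_max_norm)
qed

lemma max_norm_minus: "max_norm (- Z) = max_norm Z"
  using max_norm_scaleR[of "- 1" Z] by simp

text \<open>
  Remainder estimates are made in the Euclidean norm and the condition number is measured in the
  maximum norm; this mixed triangle inequality passes from one to the other.
\<close>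

lemma max_norm_diff_le_norm: "max_norm Y \<le> max_norm Z + norm (Y - Z)"
proof -
  have "\<bar>Y $ i $ j\<bar> \<le> max_norm Z + norm (Y - Z)" for i j
  proof -
    have "\<bar>Y $ i $ j\<bar> \<le> \<bar>Z $ i $ j\<bar> + \<bar>(Y - Z) $ i $ j\<bar>" by simp
    also have "\<bar>(Y - Z) $ i $ j\<bar> \<le> norm ((Y - Z) $ i)" by (rule component_le_norm_cart)
    also have "\<dots> \<le> norm (Y - Z)" by (rule Finite_Cartesian_Product.norm_nth_le)
    finally show ?thesis using abs_entry_le_max_norm[of Z i j] by linarith
  qed
  then show ?thesis by (simp add: max_norm_le_iff)
qed

lemma max_norm_weighted_sum_le:
  assumes "\<And>k. k \<in> J \<Longrightarrow> \<bar>c k\<bar> \<le> e k"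
  shows "max_norm (\<Sum>k\<in>J. c k *\<^sub>R D k) \<le> max_norm (\<Sum>k\<in>J. e k *\<^sub>R \<bar>D k\<bar>)"
proof -
  have "\<bar>(\<Sum>k\<in>J. c k *\<^sub>R D k) $ i $ j\<bar> \<le> max_norm (\<Sum>k\<in>J. e k *\<^sub>R \<bar>D k\<bar>)" for i j
  proof -
    have "\<bar>\<Sum>k\<in>J. c k * D k $ i $ j\<bar> \<le> (\<Sum>k\<in>J. e k * \<bar>D k $ i $ j\<bar>)"
      by (rule order_trans[OF sum_abs]) (auto simp: abs_mult intro!: sum_mono mult_right_mono assms)
    also have "\<dots> = (\<Sum>k\<in>J. e k *\<^sub>R \<bar>D k\<bar>) $ i $ j" by (simp add: abs_vec_def)
    also have "\<dots> \<le> max_norm (\<Sum>k\<in>J. e k *\<^sub>R \<bar>D k\<bar>)"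
      using abs_entry_le_max_norm abs_ge_self order_trans by blast
    finally show ?thesis by simp
  qed
  then show ?thesis by (simp add: max_norm_le_iff)
qed

text \<open>
  The signs are read off from the entry at which the weighted sum of absolute values is largest: there,
  all terms of the signed sum become nonnegative.
\<close>

lemma max_norm_weighted_sum_attained:
  assumes "\<And>k. k \<in> J \<Longrightarrow> 0 \<le> e k"
  obtains \<sigma> :: "'k \<Rightarrow> real" where "\<And>k. \<bar>\<sigma> k\<bar> \<le> 1"
    and "max_norm (\<Sum>k\<in>J. (e k * \<sigma> k) *\<^sub>R D k) = max_norm (\<Sum>k\<in>J. e k *\<^sub>R \<bar>D k\<bar>)"
proof -
  let ?S = "\<Sum>k\<in>J. e k *\<^sub>R \<bar>D k\<bar>"
  obtain i j where ij: "max_norm ?S = \<bar>?S $ i $ j\<bar>" by (rule max_norm_attained)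
  define \<sigma> where "\<sigma> k = sgn (D k $ i $ j)" for k
  have \<sigma>: "\<bar>\<sigma> k\<bar> \<le> 1" for k by (simp add: \<sigma>_def abs_sgn_eq)
  have "\<bar>D k $ i $ j\<bar> = \<sigma> k * D k $ i $ j" for k
    by (simp add: \<sigma>_def sgn_if)
  then have "?S $ i $ j = (\<Sum>k\<in>J. (e k * \<sigma> k) *\<^sub>R D k) $ i $ j"
    by (simp add: abs_vec_def mult.assoc)
  then have "max_norm ?S = \<bar>(\<Sum>k\<in>J. (e k * \<sigma> k) *\<^sub>R D k) $ i $ j\<bar>"
    by (simp only: ij)
  then have "max_norm ?S \<le> max_norm (\<Sum>k\<in>J. (e k * \<sigma> k) *\<^sub>R D k)"
    by (simp only: abs_entry_le_max_norm)
  moreover have "max_norm (\<Sum>k\<in>J. (e k * \<sigma> k) *\<^sub>R D k) \<le> max_norm ?S"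
  proof (rule max_norm_weighted_sum_le)
    fix k assume "k \<in> J"
    then have "e k * \<bar>\<sigma> k\<bar> \<le> e k * 1" by (intro mult_left_mono \<sigma> assms)
    then show "\<bar>e k * \<sigma> k\<bar> \<le> e k" using assms[OF \<open>k \<in> J\<close>] by (simp add: abs_mult)
  qed
  ultimately show ?thesis using that[of \<sigma>] \<sigma> by simp
qed

section \<open>First-order expansion of a perturbed linear system\<close>

lemma bounded_bilinear_matrix_mult:
  "bounded_bilinear ((**) :: real^'n^'l \<Rightarrow> real^'m^'n \<Rightarrow> real^'m^'l)"
  unfolding bilinear_conv_bounded_bilinear[symmetric] bilinear_def
  by (auto intro!: linearI simp: matrix_matrix_mult_def vec_eq_iff algebra_simps
      sum_distrib_left sum.distrib)

text \<open>
  Total differentiability of the entries makes their partial derivatives assemble into a Frechet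
  derivative of the matrix; the mere existence of the partial derivatives would not.
\<close>

lemma has_derivative_matrix_partial:
  fixes F :: "real^'k \<Rightarrow> real^'m^'n"
  assumes "\<And>i j. (\<lambda>w. F w $ i $ j) differentiable (at w)"
  shows "(F has_derivative (\<lambda>h. \<Sum>k\<in>UNIV. (h $ k) *\<^sub>R matrix_partial F k w)) (at w)"
proof -
  have entry: "((\<lambda>w. F w $ i $ j) has_derivative
      (\<lambda>h. (\<Sum>k\<in>UNIV. (h $ k) *\<^sub>R matrix_partial F k w) $ i $ j)) (at w)" for i j
  proof -
    obtain D where D: "((\<lambda>w. F w $ i $ j) has_derivative D) (at w)"
      using assms unfolding differentiable_def by blast
    then have lin: "linear D" by (blast dest: has_derivative_linear)
    have partial: "D (axis k 1) = matrix_partial F k w $ i $ j" for k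
    proof -
      have line: "((\<lambda>t. w + t *\<^sub>R axis k 1) has_derivative (\<lambda>t. t *\<^sub>R axis k 1)) (at 0)"
        by (auto intro!: derivative_eq_intros)
      have "((\<lambda>t. F (w + t *\<^sub>R axis k 1) $ i $ j) has_derivative (\<lambda>t. D (t *\<^sub>R axis k 1))) (at 0)"
        using has_derivative_compose[OF line, of "\<lambda>w. F w $ i $ j" D] D by simp
      then have "((\<lambda>t. F (w + t *\<^sub>R axis k 1) $ i $ j) has_field_derivative D (axis k 1)) (at 0)"
        by (simp add: has_field_derivative_def linear_scale[OF lin] mult_commute_abs)
      then show ?thesis by (simp add: matrix_partial_def DERIV_imp_deriv)
    qed
    have "D h = (\<Sum>k\<in>UNIV. (h $ k) *\<^sub>R matrix_partial F k w) $ i $ j" for h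
    proof -
      have "D h = D (\<Sum>k\<in>UNIV. (h $ k) *\<^sub>R axis k 1)"
        using basis_expansion[of h] by (simp add: scalar_mult_eq_scaleR)
      also have "\<dots> = (\<Sum>k\<in>UNIV. (h $ k) * D (axis k 1))"
        by (simp add: linear_sum[OF lin] linear_scale[OF lin])
      finally show ?thesis by (simp add: partial)
    qed
    then have "D = (\<lambda>h. (\<Sum>k\<in>UNIV. (h $ k) *\<^sub>R matrix_partial F k w) $ i $ j)" by (rule ext)
    with D show ?thesis by (rule back_subst)
  qed
  then show ?thesis
    unfolding has_derivative_componentwise_within[of F]
    by (auto simp: Basis_vec_def inner_axis)
qed

text \<open>
  Writing \<open>U h = mat 1 + D\<close>, a solution satisfies \<open>Z = V h - D ** Z\<close>. Once \<open>D\<close> is small, this first bounds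
  \<open>norm Z\<close> by a constant times \<open>norm h\<close>, and then shows that replacing \<open>Z\<close> by \<open>V h\<close>, and \<open>V h\<close> by \<open>V' h\<close>,
  costs only \<open>\<epsilon> * norm h\<close>. The filter is \<open>nhds 0\<close> and not \<open>at 0\<close> because the zero perturbation is
  always admissible.
\<close>

lemma linearized_linear_system:
  fixes U :: "'v::real_normed_vector \<Rightarrow> real^'n^'n" and V :: "'v \<Rightarrow> real^'m^'n"
  assumes U: "(U \<longlongrightarrow> mat 1) (nhds 0)"
    and V: "(V has_derivative V') (at 0)" and V0: "V 0 = 0" and "\<epsilon> > 0"
  shows "\<forall>\<^sub>F h in nhds 0. invertible (U h) \<and>
           (\<forall>Z. U h ** Z = V h \<longrightarrow> norm (Z - V' h) \<le> \<epsilon> * norm h)"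
proof -
  obtain C where C: "C > 0" "\<And>(D::real^'n^'n) (Z::real^'m^'n). norm (D ** Z) \<le> norm D * norm Z * C"
    using bounded_bilinear.pos_bounded[OF bounded_bilinear_matrix_mult] by blast
  obtain L where L: "L > 0" "\<And>h. norm (V' h) \<le> norm h * L"
    using bounded_linear.pos_bounded[OF has_derivative_bounded_linear[OF V]] by blast
  \<comment> \<open>The bound \<open>1/2\<close> absorbs \<open>D ** Z\<close> into \<open>Z\<close>, giving \<open>norm Z \<le> 2 * (L + 1) * norm h\<close>; the other bound
    makes \<open>D ** Z\<close> use up at most half of \<open>\<epsilon> * norm h\<close>.\<close>
  define \<kappa> where "\<kappa> = min (1/2) (\<epsilon> / (4 * (L + 1)))"
  have \<kappa>_half: "\<kappa> \<le> 1/2" and "\<kappa> \<le> \<epsilon> / (4 * (L + 1))"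
    unfolding \<kappa>_def by (rule min.cobounded1, rule min.cobounded2)
  then have \<kappa>_le: "\<kappa> * (4 * (L + 1)) \<le> \<epsilon>"
    using L(1) by (simp add: pos_le_divide_eq)
  have \<kappa>_pos: "\<kappa> > 0"
    using \<open>\<epsilon> > 0\<close> L(1) by (simp add: \<kappa>_def)
  have "((\<lambda>h. det (U h)) \<longlongrightarrow> det (mat 1 :: real^'n^'n)) (nhds 0)"
    unfolding det_def by (intro tendsto_intros U)
  then have ev_inv: "\<forall>\<^sub>F h in nhds 0. invertible (U h)"
    using tendsto_imp_eventually_ne[of "\<lambda>h. det (U h)" 1 _ 0]
    by (simp add: invertible_det_nz)
  have ev_U: "\<forall>\<^sub>F h in nhds 0. norm (U h - mat 1) < \<kappa> / C"
    using tendstoD[OF U, of "\<kappa> / C"] \<kappa>_pos C by (simp add: dist_norm)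
  have ev_V: "\<forall>\<^sub>F h in nhds 0. norm (V h - V' h) \<le> min 1 (\<epsilon> / 2) * norm h"
  proof -
    have "0 < min 1 (\<epsilon> / 2)" using \<open>\<epsilon> > 0\<close> by simp
    then show ?thesis
      using V V0 unfolding has_derivative_at_alt eventually_nhds_metric dist_norm by force
  qed
  from ev_inv ev_U ev_V show ?thesis
  proof eventually_elim
    case (elim h)
    have "norm (Z - V' h) \<le> \<epsilon> * norm h" if Z: "U h ** Z = V h" for Z
    proof -
      let ?D = "U h - mat 1"
      have "norm ?D * C \<le> \<kappa>" using elim(2) C(1) by (simp add: field_simps)
      then have DZ: "norm (?D ** Z) \<le> \<kappa> * norm Z"
        using C(2)[of ?D Z] mult_right_mono[of "norm ?D * C" \<kappa> "norm Z"] by (simp add: ac_simps)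
      have Zeq: "V h = Z + ?D ** Z"
        using Z by (simp add: bounded_bilinear.diff_left[OF bounded_bilinear_matrix_mult])
      have "norm (V h) \<le> norm (V' h) + norm (V h - V' h)"
        using norm_triangle_ineq[of "V' h" "V h - V' h"] by simp
      also have "norm (V h - V' h) \<le> 1 * norm h"
        by (rule order_trans[OF elim(3)], rule mult_right_mono) auto
      finally have Vh: "norm (V h) \<le> (L + 1) * norm h"
        using L(2)[of h] by (simp add: algebra_simps)
      have "norm Z \<le> norm (V h) + norm (?D ** Z)"
        using norm_triangle_ineq4[of "V h" "?D ** Z"] Zeq by simp
      moreover have "\<kappa> * norm Z \<le> 1/2 * norm Z" using \<kappa>_pos \<kappa>_half by (intro mult_right_mono) auto
      ultimately have "norm Z \<le> 2 * ((L + 1) * norm h)" using Vh DZ by simp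
      then have "\<kappa> * norm Z \<le> \<kappa> * (2 * ((L + 1) * norm h))"
        using \<kappa>_pos \<kappa>_half by (intro mult_left_mono) auto
      also have "\<dots> = (\<kappa> * (4 * (L + 1))) * norm h / 2" by simp
      also have "\<dots> \<le> \<epsilon> * norm h / 2"
        using mult_right_mono[OF \<kappa>_le, of "norm h"] by simp
      finally have "norm (?D ** Z) \<le> \<epsilon> / 2 * norm h" using DZ by simp
      moreover have "norm (V h - V' h) \<le> \<epsilon> / 2 * norm h"
        by (rule order_trans[OF elim(3)], rule mult_right_mono) auto
      moreover have "Z - V' h = (V h - V' h) - ?D ** Z" using Zeq by simp
      then have "norm (Z - V' h) \<le> norm (V h - V' h) + norm (?D ** Z)"
        by (simp only: norm_triangle_ineq4)
      ultimately show ?thesis by linarith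
    qed
    then show ?case using elim(1) by blast
  qed
qed

section \<open>The componentwise condition number\<close>

lemma norm_le_of_abs_le:
  fixes x y :: "real^'k"
  assumes "\<bar>x\<bar> \<le> y" shows "norm x \<le> norm y"
proof (rule norm_le_componentwise_cart)
  fix i
  have "\<bar>x $ i\<bar> \<le> y $ i" using assms by (simp add: less_eq_vec_def abs_vec_def)
  then show "norm (x $ i) \<le> norm (y $ i)" by simp
qed

lemma sum_reindex_initial_segment:
  fixes g :: "'k::finite \<Rightarrow> 'c::comm_monoid_add" and p N :: nat
  assumes "bij_betw a {1..N} UNIV" and "p \<le> N"
  shows "(\<Sum>l\<in>UNIV. g l) = (\<Sum>k=1..p. g (a k)) + (\<Sum>k=p+1..N. g (a k))"
proof -
  have "(\<Sum>l\<in>UNIV. g l) = (\<Sum>k=1..N. g (a k))"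
    by (rule sum.reindex_bij_betw[OF assms(1), symmetric])
  then show ?thesis using sum.ub_add_nat[of 1 p "\<lambda>k. g (a k)" "N - p"] assms(2) by simp
qed

lemma tendsto_ereal_of_eventually_close:
  assumes "\<And>\<epsilon>. \<epsilon> > 0 \<Longrightarrow> \<forall>\<^sub>F x in F. ereal (K - \<epsilon>) \<le> g x \<and> g x \<le> ereal (K + \<epsilon>)"
  shows "(g \<longlongrightarrow> ereal K) F"
proof (rule order_tendstoI)
  fix y assume "y < ereal K"
  then obtain c where c: "y < ereal c" "c < K" using ereal_dense2 by fastforce
  show "\<forall>\<^sub>F x in F. y < g x"
    using assms[of "K - c"] c by (auto elim!: eventually_mono)
next
  fix y assume "ereal K < y"
  then obtain c where c: "ereal c < y" "K < c" using ereal_dense2 by fastforce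
  show "\<forall>\<^sub>F x in F. g x < y"
    using assms[of "c - K"] c by (auto elim!: eventually_mono)
qed

theorem theorem3p1:
  fixes A :: "real^'N \<Rightarrow> real^'n^'n" and B :: "real^'M \<Rightarrow> real^'m^'n"
    and \<Omega>A :: "real^'N" and \<Omega>B :: "real^'M" and X :: "real^'m^'n"
    and E :: "real^'N" and f :: "real^'M"
    and N M p :: nat and a :: "nat \<Rightarrow> 'N" and b :: "nat \<Rightarrow> 'M"
  assumes "bij_betw a {1..N} UNIV" and "bij_betw b {1..M} UNIV"
    and "p \<le> N" and "p \<le> M"
    and "\<And>k. k \<in> {1..p} \<Longrightarrow> \<Omega>A $ a k = \<Omega>B $ b k"
    and "\<And>i j. (\<lambda>w. A w $ i $ j) differentiable (at \<Omega>A)"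
    and "\<And>i j. (\<lambda>w. B w $ i $ j) differentiable (at \<Omega>B)"
    and "invertible (A \<Omega>A)"
    and "A \<Omega>A ** X = B \<Omega>B"
    and "\<And>i j. X $ i $ j \<noteq> 0"
    and "0 \<le> E" and "0 \<le> f"
    and "\<And>k. k \<in> {1..p} \<Longrightarrow> E $ a k = f $ b k"
  shows "let K = 1 / max_norm X * max_norm (
            (\<Sum>k=1..p. (E $ a k) *\<^sub>R
                \<bar>matrix_inv (A \<Omega>A) ** matrix_partial A (a k) \<Omega>A ** X
                  - matrix_inv (A \<Omega>A) ** matrix_partial B (b k) \<Omega>B\<bar>)
          + (\<Sum>k=p+1..N. (E $ a k) *\<^sub>R
                \<bar>matrix_inv (A \<Omega>A) ** matrix_partial A (a k) \<Omega>A ** X\<bar>)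
          + (\<Sum>k=p+1..M. (f $ b k) *\<^sub>R
                \<bar>matrix_inv (A \<Omega>A) ** matrix_partial B (b k) \<Omega>B\<bar>))
         in (worst_rel_error p a b A \<Omega>A B \<Omega>B X E f \<longlongrightarrow> ereal K) (at_right 0) \<and>
            condition_number p a b A \<Omega>A B \<Omega>B X E f = ereal K"
proof -
  note bij_a = assms(1) and bij_b = assms(2) and p_le = assms(3,4)
  define G where "G = matrix_inv (A \<Omega>A)"
  have G: "A \<Omega>A ** G = mat 1" "G ** A \<Omega>A = mat 1"
    using someI_ex[OF assms(8)[unfolded invertible_def]]
    unfolding G_def matrix_inv_def by blast+
  define PA where "PA k = G ** matrix_partial A (a k) \<Omega>A ** X" for k
  define PB where "PB k = G ** matrix_partial B (b k) \<Omega>B" for k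
  \<comment> \<open>\<open>J\<close> indexes the independent parameters: \<open>Inl k\<close> stands for the \<open>k\<close>-th parameter of \<open>A\<close>, common to
    both matrices if \<open>k \<le> p\<close>, and \<open>Inr k\<close> for the \<open>k\<close>-th parameter of \<open>B\<close>, which occurs only there.\<close>
  define J :: "(nat + nat) set" where "J = {1..N} <+> {p+1..M}"
  define D where "D = case_sum (\<lambda>k. if k \<le> p then PA k - PB k else PA k) (\<lambda>k. - PB k)"
  define e where "e = case_sum (\<lambda>k. E $ a k) (\<lambda>k. f $ b k)"
  define S where "S = (\<Sum>j\<in>J. e j *\<^sub>R \<bar>D j\<bar>)"

  have sum_J: "(\<Sum>j\<in>J. g j) = (\<Sum>k=1..p. g (Inl k)) + (\<Sum>k=p+1..N. g (Inl k)) + (\<Sum>k=p+1..M. g (Inr k))"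
    for g :: "nat + nat \<Rightarrow> real^'m^'n"
  proof -
    have "(\<Sum>k=1..N. g (Inl k)) = (\<Sum>k=1..p. g (Inl k)) + (\<Sum>k=p+1..N. g (Inl k))"
      using sum.ub_add_nat[of 1 p "\<lambda>k. g (Inl k)" "N - p"] p_le by simp
    then show ?thesis by (simp add: J_def sum.Plus)
  qed
  have abs_minus: "\<bar>- Z\<bar> = \<bar>Z\<bar>" for Z :: "real^'m^'n"
    by (simp add: abs_vec_def vec_eq_iff)
  have S_eq: "S = (\<Sum>k=1..p. (E $ a k) *\<^sub>R \<bar>PA k - PB k\<bar>) + (\<Sum>k=p+1..N. (E $ a k) *\<^sub>R \<bar>PA k\<bar>)
      + (\<Sum>k=p+1..M. (f $ b k) *\<^sub>R \<bar>PB k\<bar>)"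
    by (simp add: S_def sum_J D_def e_def abs_minus)

  define U where "U h = G ** A (\<Omega>A + fst h)" for h :: "(real^'N) \<times> (real^'M)"
  define V where "V h = G ** (B (\<Omega>B + snd h) - A (\<Omega>A + fst h) ** X)" for h :: "(real^'N) \<times> (real^'M)"
  define V' where "V' h = G ** ((\<Sum>l\<in>UNIV. (snd h $ l) *\<^sub>R matrix_partial B l \<Omega>B)
      - (\<Sum>l\<in>UNIV. (fst h $ l) *\<^sub>R matrix_partial A l \<Omega>A) ** X)" for h :: "(real^'N) \<times> (real^'M)"
  note mult_right_linear = bounded_bilinear.bounded_linear_right[OF bounded_bilinear_matrix_mult]
   and mult_left_linear = bounded_bilinear.bounded_linear_left[OF bounded_bilinear_matrix_mult]

  have A': "((\<lambda>h. A (\<Omega>A + fst h)) has_derivative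
      (\<lambda>h. \<Sum>l\<in>UNIV. (fst h $ l) *\<^sub>R matrix_partial A l \<Omega>A)) (at (0::(real^'N) \<times> (real^'M)))"
  proof -
    have "((\<lambda>h. \<Omega>A + fst h) has_derivative fst) (at (0::(real^'N) \<times> (real^'M)))"
      by (auto intro!: derivative_eq_intros)
    from has_derivative_compose[OF this, of A] show ?thesis
      using has_derivative_matrix_partial[of A \<Omega>A] assms(6) by simp
  qed
  have B': "((\<lambda>h. B (\<Omega>B + snd h)) has_derivative
      (\<lambda>h. \<Sum>l\<in>UNIV. (snd h $ l) *\<^sub>R matrix_partial B l \<Omega>B)) (at (0::(real^'N) \<times> (real^'M)))"
  proof -
    have "((\<lambda>h. \<Omega>B + snd h) has_derivative snd) (at (0::(real^'N) \<times> (real^'M)))"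
      by (auto intro!: derivative_eq_intros)
    from has_derivative_compose[OF this, of B] show ?thesis
      using has_derivative_matrix_partial[of B \<Omega>B] assms(7) by simp
  qed
  have V_deriv: "(V has_derivative V') (at 0)"
    unfolding V_def V'_def
    by (intro bounded_linear.has_derivative[OF mult_right_linear]
        bounded_linear.has_derivative[OF mult_left_linear] has_derivative_diff A' B')
  have V0: "V 0 = 0"
    using assms(9) bounded_linear.linear[OF mult_right_linear, of G]
    by (simp add: V_def linear_0)
  have U_lim: "(U \<longlongrightarrow> mat 1) (nhds 0)"
  proof -
    have "isCont U 0"
      unfolding U_def
      using bounded_linear.has_derivative[OF mult_right_linear A'] has_derivative_continuous by blast
    then have "(U \<longlongrightarrow> U 0) (nhds 0)"
      by (simp add: isCont_def tendsto_at_iff_tendsto_nhds)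
    then show ?thesis using G by (simp add: U_def)
  qed

  have solves_iff: "A (\<Omega>A + dA) ** (X + dX) = B (\<Omega>B + dB) \<longleftrightarrow> U (dA, dB) ** dX = V (dA, dB)"
    for dA dB dX
  proof -
    let ?r = "B (\<Omega>B + dB) - A (\<Omega>A + dA) ** X"
    have "A (\<Omega>A + dA) ** (X + dX) = B (\<Omega>B + dB) \<longleftrightarrow> A (\<Omega>A + dA) ** dX = ?r"
      by (auto simp: matrix_add_ldistrib algebra_simps)
    also have "\<dots> \<longleftrightarrow> G ** (A (\<Omega>A + dA) ** dX) = G ** ?r"
      by (metis G(1) matrix_mul_assoc matrix_mul_lid)
    finally show ?thesis by (simp add: U_def V_def matrix_mul_assoc)
  qed

  \<comment> \<open>Merging the two occurrences of each common parameter is what makes the coefficients on the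
    right independent of each other.\<close>
  have V'_eq: "V' (dA, dB) = - (\<Sum>j\<in>J. case_sum (\<lambda>k. dA $ a k) (\<lambda>k. dB $ b k) j *\<^sub>R D j)"
    if common: "\<And>k. k \<in> {1..p} \<Longrightarrow> dA $ a k = dB $ b k" for dA dB
  proof -
    have "V' (dA, dB) = (\<Sum>l\<in>UNIV. (dB $ l) *\<^sub>R (G ** matrix_partial B l \<Omega>B))
        - (\<Sum>l\<in>UNIV. (dA $ l) *\<^sub>R (G ** matrix_partial A l \<Omega>A ** X))"
      unfolding V'_def
      by (simp add: bounded_bilinear.diff_right[OF bounded_bilinear_matrix_mult]
          bounded_bilinear.sum_right[OF bounded_bilinear_matrix_mult]
          bounded_bilinear.sum_left[OF bounded_bilinear_matrix_mult]
          bounded_bilinear.scaleR_right[OF bounded_bilinear_matrix_mult]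
          bounded_bilinear.scaleR_left[OF bounded_bilinear_matrix_mult] matrix_mul_assoc)
    also have "\<dots> = ((\<Sum>k=1..p. (dB $ b k) *\<^sub>R PB k) + (\<Sum>k=p+1..M. (dB $ b k) *\<^sub>R PB k))
        - ((\<Sum>k=1..p. (dA $ a k) *\<^sub>R PA k) + (\<Sum>k=p+1..N. (dA $ a k) *\<^sub>R PA k))"
      by (simp only: sum_reindex_initial_segment[OF bij_a p_le(1)]
          sum_reindex_initial_segment[OF bij_b p_le(2)] PA_def PB_def)
    also have "(\<Sum>k=1..p. (dB $ b k) *\<^sub>R PB k) = (\<Sum>k=1..p. (dA $ a k) *\<^sub>R PB k)"
      using common by simp
    finally show ?thesis
      by (simp add: sum_J D_def scaleR_diff_right sum_subtractf sum_negf)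
  qed

  have nonneg: "0 \<le> e j" for j
    using assms(11,12) by (cases j) (auto simp: e_def less_eq_vec_def)
  have max_norm_V'_le: "max_norm (V' (dA, dB)) \<le> \<eta> * max_norm S"
    if "\<bar>dA\<bar> \<le> \<eta> *\<^sub>R E" "\<bar>dB\<bar> \<le> \<eta> *\<^sub>R f" "\<And>k. k \<in> {1..p} \<Longrightarrow> dA $ a k = dB $ b k" "\<eta> > 0"
    for dA dB \<eta>
  proof -
    have "max_norm (V' (dA, dB)) \<le> max_norm (\<Sum>j\<in>J. (\<eta> * e j) *\<^sub>R \<bar>D j\<bar>)"
      unfolding V'_eq[OF that(3), simplified] max_norm_minus
      by (rule max_norm_weighted_sum_le)
        (use that(1,2) in \<open>auto simp: e_def less_eq_vec_def abs_vec_def split: sum.split\<close>)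
    also have "(\<Sum>j\<in>J. (\<eta> * e j) *\<^sub>R \<bar>D j\<bar>) = \<eta> *\<^sub>R S"
      by (simp add: S_def scaleR_sum_right)
    finally show ?thesis using \<open>\<eta> > 0\<close> by (simp add: max_norm_scaleR)
  qed
  have max_norm_V'_attained: "\<exists>dA dB. \<bar>dA\<bar> \<le> \<eta> *\<^sub>R E \<and> \<bar>dB\<bar> \<le> \<eta> *\<^sub>R f \<and>
      (\<forall>k\<in>{1..p}. dA $ a k = dB $ b k) \<and> max_norm (V' (dA, dB)) = \<eta> * max_norm S"
    if "\<eta> > 0" for \<eta>
  proof -
    obtain \<sigma> where \<sigma>: "\<And>j. \<bar>\<sigma> j\<bar> \<le> 1" "max_norm (\<Sum>j\<in>J. (e j * \<sigma> j) *\<^sub>R D j) = max_norm S"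
      by (rule max_norm_weighted_sum_attained[of J e D, OF nonneg, folded S_def]) blast
    \<comment> \<open>A common component of \<open>dB\<close> takes its sign from \<open>Inl k\<close>, so that it coincides with that of \<open>dA\<close>.\<close>
    define dA where "dA = (\<chi> l. \<eta> * E $ l * \<sigma> (Inl (inv_into {1..N} a l)))"
    define dB where "dB = (\<chi> l. \<eta> * f $ l *
        (let k = inv_into {1..M} b l in if k \<le> p then \<sigma> (Inl k) else \<sigma> (Inr k)))"
    have inv_a: "inv_into {1..N} a (a k) = k" if "k \<in> {1..N}" for k
      using bij_a that by (simp add: bij_betw_def)
    have inv_b: "inv_into {1..M} b (b k) = k" if "k \<in> {1..M}" for k
      using bij_b that by (simp add: bij_betw_def)
    have dA: "\<bar>dA\<bar> \<le> \<eta> *\<^sub>R E"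
      using assms(11) \<open>\<eta> > 0\<close>
      by (auto simp: dA_def less_eq_vec_def abs_vec_def abs_mult intro!: mult_left_le \<sigma>)
    have dB: "\<bar>dB\<bar> \<le> \<eta> *\<^sub>R f"
      using assms(12) \<open>\<eta> > 0\<close>
      by (auto simp: dB_def Let_def less_eq_vec_def abs_vec_def abs_mult intro!: mult_left_le \<sigma>)
    have common: "dA $ a k = dB $ b k" if "k \<in> {1..p}" for k
      using that p_le assms(13)[OF that] inv_a[of k] inv_b[of k] by (simp add: dA_def dB_def)
    have "(\<Sum>j\<in>J. case_sum (\<lambda>k. dA $ a k) (\<lambda>k. dB $ b k) j *\<^sub>R D j)
        = \<eta> *\<^sub>R (\<Sum>j\<in>J. (e j * \<sigma> j) *\<^sub>R D j)"
      unfolding scaleR_sum_right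
      by (rule sum.cong) (auto simp: J_def e_def dA_def dB_def inv_a inv_b simp del: One_nat_def)
    then have "V' (dA, dB) = - (\<eta> *\<^sub>R (\<Sum>j\<in>J. (e j * \<sigma> j) *\<^sub>R D j))"
      by (simp only: V'_eq[OF common])
    then have "max_norm (V' (dA, dB)) = \<eta> * max_norm S"
      using \<open>\<eta> > 0\<close> by (simp only: max_norm_minus max_norm_scaleR \<sigma>(2) abs_of_pos)
    then show ?thesis using dA dB common by blast
  qed

  have X_pos: "max_norm X > 0"
    using abs_entry_le_max_norm[of X] assms(10) by (metis zero_less_abs_iff less_le_trans)
  define K where "K = 1 / max_norm X * max_norm S"
  \<comment> \<open>Adding \<open>1\<close> keeps \<open>H\<close> positive even if no parameter is perturbed.\<close>
  define H where "H = norm (E, f) + 1"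
  have H: "H > 0" "norm (E, f) \<le> H" by (auto simp: H_def add_nonneg_pos)
  have small: "norm (dA, dB) \<le> \<eta> * H"
    if "\<bar>dA\<bar> \<le> \<eta> *\<^sub>R E" "\<bar>dB\<bar> \<le> \<eta> *\<^sub>R f" "\<eta> > 0" for dA dB \<eta>
  proof -
    have "norm (dA, dB) \<le> norm (\<eta> *\<^sub>R E, \<eta> *\<^sub>R f)"
      unfolding norm_Pair
      by (intro real_sqrt_le_mono add_mono power_mono norm_le_of_abs_le that norm_ge_zero)
    also have "\<dots> = \<eta> * norm (E, f)"
      using \<open>\<eta> > 0\<close> norm_scaleR[of \<eta> "(E, f)"] by simp
    finally show ?thesis using H(2) \<open>\<eta> > 0\<close> mult_left_mono[of "norm (E, f)" H \<eta>] by linarith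
  qed

  let ?W = "worst_rel_error p a b A \<Omega>A B \<Omega>B X E f"
  have "(?W \<longlongrightarrow> ereal K) (at_right 0)"
  proof (rule tendsto_ereal_of_eventually_close)
    fix \<epsilon> :: real assume "\<epsilon> > 0"
    \<comment> \<open>Chosen so that an error of \<open>\<epsilon>' * (\<eta> * H)\<close> in \<open>dX\<close> amounts to \<open>\<epsilon>\<close> after division by
      \<open>\<eta> * max_norm X\<close>.\<close>
    define \<epsilon>' where "\<epsilon>' = \<epsilon> * max_norm X / H"
    have "\<epsilon>' > 0" using \<open>\<epsilon> > 0\<close> X_pos H by (simp add: \<epsilon>'_def)
    from linearized_linear_system[OF U_lim V_deriv V0 this]
    obtain \<delta> where "\<delta> > 0" and \<delta>: "\<And>h. norm h < \<delta> \<Longrightarrow> invertible (U h)"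
      "\<And>h Z. norm h < \<delta> \<Longrightarrow> U h ** Z = V h \<Longrightarrow> norm (Z - V' h) \<le> \<epsilon>' * norm h"
      unfolding eventually_nhds_metric by (auto simp: dist_norm)
    have "\<forall>\<^sub>F \<eta> in at_right 0. \<eta> \<in> {0<..<\<delta> / H}"
      using \<open>\<delta> > 0\<close> H by (intro eventually_at_right_real) simp
    then show "\<forall>\<^sub>F \<eta> in at_right 0. ereal (K - \<epsilon>) \<le> ?W \<eta> \<and> ?W \<eta> \<le> ereal (K + \<epsilon>)"
    proof eventually_elim
      case (elim \<eta>)
      then have \<eta>: "\<eta> > 0" "\<eta> * H < \<delta>" using H by (auto simp: field_simps)
      \<comment> \<open>Used with \<open>r = 1\<close> for the upper and \<open>r = - 1\<close> for the lower bound.\<close>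
      have rescale: "1 / \<eta> * ((\<eta> * max_norm S + r * (\<epsilon>' * (\<eta> * H))) / max_norm X) = K + r * \<epsilon>" for r
        using \<eta>(1) X_pos H by (simp add: K_def \<epsilon>'_def field_simps)
      have near: "norm (dX - V' (dA, dB)) \<le> \<epsilon>' * (\<eta> * H)"
        if "U (dA, dB) ** dX = V (dA, dB)" "\<bar>dA\<bar> \<le> \<eta> *\<^sub>R E" "\<bar>dB\<bar> \<le> \<eta> *\<^sub>R f" for dA dB dX
        using \<delta>(2)[OF _ that(1)] small[OF that(2,3) \<eta>(1)] \<eta>(2)
          mult_left_mono[of "norm (dA, dB)" "\<eta> * H" \<epsilon>'] \<open>\<epsilon>' > 0\<close> by linarith
      have "?W \<eta> \<le> ereal (K + \<epsilon>)"
        unfolding worst_rel_error_def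
      proof (rule Sup_least, clarify)
        fix dX dA dB
        assume eq: "A (\<Omega>A + dA) ** (X + dX) = B (\<Omega>B + dB)"
          and le: "\<bar>dA\<bar> \<le> \<eta> *\<^sub>R E" "\<bar>dB\<bar> \<le> \<eta> *\<^sub>R f" and "\<forall>k\<in>{1..p}. dA $ a k = dB $ b k"
        then have "max_norm (V' (dA, dB)) \<le> \<eta> * max_norm S"
          using max_norm_V'_le \<eta>(1) by blast
        then have "max_norm dX \<le> \<eta> * max_norm S + 1 * (\<epsilon>' * (\<eta> * H))"
          using max_norm_diff_le_norm[of dX "V' (dA, dB)"] near[OF eq[unfolded solves_iff] le] by simp
        then have "1 / \<eta> * (max_norm dX / max_norm X) \<le> K + 1 * \<epsilon>"
          unfolding rescale[symmetric] using \<eta>(1) X_pos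
          by (intro mult_left_mono divide_right_mono) auto
        then show "ereal (1 / \<eta> * (max_norm dX / max_norm X)) \<le> ereal (K + \<epsilon>)" by simp
      qed
      moreover have "ereal (K - \<epsilon>) \<le> ?W \<eta>"
      proof -
        obtain dA dB where le: "\<bar>dA\<bar> \<le> \<eta> *\<^sub>R E" "\<bar>dB\<bar> \<le> \<eta> *\<^sub>R f"
          and common: "\<forall>k\<in>{1..p}. dA $ a k = dB $ b k"
          and attained: "max_norm (V' (dA, dB)) = \<eta> * max_norm S"
          using max_norm_V'_attained[OF \<eta>(1)] by blast
        have "invertible (U (dA, dB))"
          using \<delta>(1) small[OF le \<eta>(1)] \<eta>(2) by simp
        then obtain Y where "U (dA, dB) ** Y = mat 1" unfolding invertible_def by blast
        then have dX: "U (dA, dB) ** (Y ** V (dA, dB)) = V (dA, dB)"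
          by (simp add: matrix_mul_assoc)
        let ?dX = "Y ** V (dA, dB)"
        have "\<eta> * max_norm S + (- 1) * (\<epsilon>' * (\<eta> * H)) \<le> max_norm ?dX"
          using max_norm_diff_le_norm[of "V' (dA, dB)" ?dX] near[OF dX le] attained
          by (simp add: norm_minus_commute)
        then have "K + (- 1) * \<epsilon> \<le> 1 / \<eta> * (max_norm ?dX / max_norm X)"
          unfolding rescale[symmetric] using \<eta>(1) X_pos
          by (intro mult_left_mono divide_right_mono) auto
        then have "ereal (K - \<epsilon>) \<le> ereal (1 / \<eta> * (max_norm ?dX / max_norm X))" by simp
        also have "\<dots> \<le> ?W \<eta>"
          unfolding worst_rel_error_def
          using le common dX[folded solves_iff] by (intro Sup_upper) blast
        finally show ?thesis .
      qed
      ultimately show ?case by blast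
    qed
  qed
  moreover from this have "condition_number p a b A \<Omega>A B \<Omega>B X E f = ereal K"
    unfolding condition_number_def by (intro tendsto_Lim) simp_all
  ultimately show ?thesis
    by (simp add: Let_def K_def S_eq PA_def PB_def G_def)
qed

end
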